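(* Let $A\in\mathbb{R}^{m\times n}$, $B\in\mathbb{R}^{s\times n}$, $b\in\mathbb{R}^m$, $d\in\mathbb{R}^s$ with $\mathrm{rank}(B)=s$ and $A^TJA$ positive definite, where $J=\mathrm{diag}(I_p,-I_q)$, $p+q=m$. Let $x$ be the unique solution of the EILS problem $\min_{x\in\mathbb{R}^n}(b-Ax)^TJ(b-Ax)$ subject to $Bx=d$. Let $L\in\mathbb{R}^{n\times k}$ with $\mathrm{rank}(L)=k$, let $\|\cdot\|_\eta$ be a vector norm on $\mathbb{R}^{mn+sn+m+s}$ and $\|\cdot\|_\nu$ a vector norm on $\mathbb{R}^k$, let $\xi_L\in\mathbb{R}^k$, and let $\Phi\in\mathbb{R}^{m\times n}$, $\Psi\in\mathbb{R}^{s\times n}$, $\beta\in\mathbb{R}^m$, $\vartheta\in\mathbb{R}^s$ have only nonzero entries. Then the projected condition number $\kappa_{L\mathcal{F}}(A,B,b,d)$ of the EILS problem (defined in the context) is $$\kappa_{L\mathcal{F}}(A,B,b,d)=\left\|\xi_L\circ\left(L^T\mathcal{M}_{\mathcal{F}}\,\mathrm{diag}\big(\mathrm{vec}(\Phi,\Psi,\beta,\vartheta)^{\ddagger}\big)\right)\right\|_{\eta,\nu},$$ where $$\mathcal{M}_{\mathcal{F}}=\begin{bmatrix}\Gamma, & -\Omega, & -P^TM^{-1}A^TJ, & M^{-1}B^TN^{-1}\end{bmatrix},$$ $$\Gamma=x^T\otimes(P^TM^{-1}A^TJ)-(M^{-1}P)\otimes(Jr)^T,\qquad \Omega=(M^{-1}P)\otimes\lambda^T+x^T\otimes(M^{-1}B^TN^{-1}),$$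 $M=A^TJA$, $N=BM^{-1}B^T$, $P=B^TN^{-1}BM^{-1}-I_n$, $r=b-Ax$, $\lambda=-(BB^T)^{-1}BA^TJr$, and $\|\cdot\|_{\eta,\nu}$ is the matrix norm induced by $\|\cdot\|_\eta$ (on the domain) and $\|\cdot\|_\nu$ (on the codomain).
   Context: Notation: $\mathrm{vec}(A)$ stacks the columns of $A$; $\mathrm{vec}(A,B,b,d)$ denotes the vector $[\mathrm{vec}(A)^T,\mathrm{vec}(B)^T,b^T,d^T]^T$; $\otimes$ is the Kronecker product $X\otimes Y=[x_{ij}Y]$; $\circ$ is the entrywise (Hadamard) product. For a vector $\xi\in\mathbb{R}^k$ and a matrix $X$ with $k$ rows, $\xi\circ X:=\mathrm{diag}(\xi)X$. For a real number $c$, $c^{\ddagger}=1/c$ if $c\ne0$ and $c^{\ddagger}=1$ if $c=0$; for vectors and matrices $\ddagger$ is applied entrywise. The induced norm is $\|X\|_{\eta,\nu}=\sup_{z\neq0}\|Xz\|_\nu/\|z\|_\eta$. The solution map: near the given data (the conditions that $A^TJA$ is positive definite and $B$ has full row rank are open), $\mathcal{F}(A,B,b,d)=x=M^{-1}B^TN^{-1}d-P^TM^{-1}A^TJb\in\mathbb{R}^n$, with $M=A^TJA$, $N=BM^{-1}B^T$, $P=B^TN^{-1}BM^{-1}-I_n$, is the unique solution of the EILS problem. Set $\mathcal{F}_L=L^T\mathcal{F}$. Product norm on the data space: $\|(A,B,b,d)\|_\mu:=\|\mathrm{vec}(A,B,b,d)\|_\eta$. Projected condition number: $$\kappa_{L\mathcal{F}}(A,B,b,d)=\lim_{\delta\to0^+}\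 \sup_{0<\|\rho\circ\Delta\|_\mu\le\delta}\frac{\|\xi_L\circ(\mathcal{F}_L(A+\Delta A,B+\Delta B,b+\Delta b,d+\Delta d)-\mathcal{F}_L(A,B,b,d))\|_\nu}{\|\rho\circ\Delta\|_\mu},$$ where $\rho\circ\Delta=(\Phi\circ\Delta A,\Psi\circ\Delta B,\beta\circ\Delta b,\vartheta\circ\Delta d)$ and the supremum is over all perturbations $(\Delta A,\Delta B,\Delta b,\Delta d)$. *)

theory Defs
  imports "HOL-Analysis.Analysis"
begin

text \<open>
  Dimensions are finite index types. Entrywise (Hadamard) products are written with the
  library product \<open>(*)\<close> on \<open>real^'k\<close>, which acts componentwise, hence entrywise
  also on \<open>real^'n^'m\<close>; matrix products are written \<open>(**)\<close> and \<open>(*v)\<close>.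
\<close>

definition diag_mat :: "real^'k \<Rightarrow> real^'k^'k" where
  "diag_mat v = (\<chi> i j. if i = j then v $ i else 0)"

text \<open>
  The signature matrix \<open>diag (I_p, -I_q)\<close>, where \<open>q\<close> is the number of the remaining indices:
  the row index type is linearly ordered, and the first \<open>p\<close> diagonal entries are \<open>1\<close>.
  Both \<open>p = 0\<close> and \<open>q = 0\<close> are possible.
\<close>

definition sig_mat :: "nat \<Rightarrow> real^('m::{finite,linorder})^('m::{finite,linorder})" where
  "sig_mat p = diag_mat (\<chi> i. if card {j. j < i} < p then 1 else - 1)"

definition pos_def :: "real^'n^'n \<Rightarrow> bool" where
  "pos_def S \<longleftrightarrow> transpose S = S \<and> (\<forall>v. v \<noteq> 0 \<longrightarrow> 0 < v \<bullet> (S *v v))"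

definition kron :: "real^'c1^'r1 \<Rightarrow> real^'c2^'r2 \<Rightarrow> real^('c1 \<times> 'c2)^('r1 \<times> 'r2)"
    (infixr "\<otimes>\<^sub>K" 75) where
  "X \<otimes>\<^sub>K Y = (\<chi> i j. X $ fst i $ fst j * Y $ snd i $ snd j)"

text \<open>
  A Kronecker product with a one-row matrix has row index type \<open>1 \<times> 'r\<close> or \<open>'r \<times> 1\<close>; the
  following maps identify these with \<open>'r\<close>.
\<close>

definition rows_from_left_unit :: "real^'c^(1 \<times> 'r) \<Rightarrow> real^'c^'r" where
  "rows_from_left_unit X = (\<chi> i. X $ (1, i))"

definition rows_from_right_unit :: "real^'c^('r \<times> 1) \<Rightarrow> real^'c^'r" where
  "rows_from_right_unit X = (\<chi> i. X $ (i, 1))"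

definition hcat :: "real^'c1^'r \<Rightarrow> real^'c2^'r \<Rightarrow> real^('c1 + 'c2)^'r"
    (infixr "|\<^sub>h" 66) where
  "X |\<^sub>h Y = (\<chi> i j. case j of Inl a \<Rightarrow> X $ i $ a | Inr c \<Rightarrow> Y $ i $ c)"

definition vcat :: "real^'a \<Rightarrow> real^'c \<Rightarrow> real^('a + 'c)" where
  "vcat u v = (\<chi> j. case j of Inl a \<Rightarrow> u $ a | Inr c \<Rightarrow> v $ c)"

text \<open>
  Column stacking: index \<open>(j, i)\<close> is row \<open>i\<close> of column \<open>j\<close>, so that the lexicographic order of
  the index pairs is the order of the stacked columns.
\<close>

definition mat_vec :: "real^'n^'m \<Rightarrow> real^('n \<times> 'm)" where
  "mat_vec X = (\<chi> l. X $ snd l $ fst l)"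

definition data_vec ::
    "real^'n^'m \<Rightarrow> real^'n^'s \<Rightarrow> real^'m \<Rightarrow> real^'s \<Rightarrow> real^('n \<times> 'm + 'n \<times> 's + 'm + 's)" where
  "data_vec A B b d = vcat (mat_vec A) (vcat (mat_vec B) (vcat b d))"

definition ddagger :: "real^'k \<Rightarrow> real^'k" where
  "ddagger v = (\<chi> i. if v $ i = 0 then 1 else 1 / v $ i)"

definition vector_norm :: "('a::real_vector \<Rightarrow> real) \<Rightarrow> bool" where
  "vector_norm N \<longleftrightarrow>
     (\<forall>v. 0 \<le> N v) \<and> (\<forall>v. N v = 0 \<longleftrightarrow> v = 0) \<and>
     (\<forall>c v. N (c *\<^sub>R v) = \<bar>c\<bar> * N v) \<and> (\<forall>u v. N (u + v) \<le> N u + N v)"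

text \<open>For vector norms the set below is nonempty and bounded, since the dimensions are finite.\<close>

definition induced_norm :: "(real^'c \<Rightarrow> real) \<Rightarrow> (real^'r \<Rightarrow> real) \<Rightarrow> real^'c^'r \<Rightarrow> real" where
  "induced_norm \<eta> \<nu> X = (SUP z\<in>{z. z \<noteq> 0}. \<nu> (X *v z) / \<eta> z)"

definition eils_objective :: "real^'m^'m \<Rightarrow> real^'n^'m \<Rightarrow> real^'m \<Rightarrow> real^'n \<Rightarrow> real" where
  "eils_objective J A b x = (b - A *v x) \<bullet> (J *v (b - A *v x))"

definition eils_minimizer ::
    "real^'m^'m \<Rightarrow> real^'n^'m \<Rightarrow> real^'n^'s \<Rightarrow> real^'m \<Rightarrow> real^'s \<Rightarrow> real^'n \<Rightarrow> bool" where
  "eils_minimizer J A B b d x \<longleftrightarrow> is_arg_min (eils_objective J A b) (\<lambda>y. B *v y = d) x"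

text \<open>
  The solution map. It is meaningful for data with \<open>A\<^sup>TJA\<close> positive definite and \<open>B\<close> of
  full row rank, where it has a closed form, see \<open>eils_solution_closed_form\<close> below; elsewhere
  its value may be arbitrary.
\<close>

definition eils_solution ::
    "real^'m^'m \<Rightarrow> real^'n^'m \<Rightarrow> real^'n^'s \<Rightarrow> real^'m \<Rightarrow> real^'s \<Rightarrow> real^'n" where
  "eils_solution J A B b d = (THE x. eils_minimizer J A B b d x)"

lemma pos_def_inv:
  fixes S :: "real^'n^'n"
  assumes "pos_def S"
  shows "S ** matrix_inv S = mat 1" "matrix_inv S ** S = mat 1"
proof -
  have "S *v v \<noteq> 0" if "v \<noteq> 0" for v
    using assms that by (force simp: pos_def_def)
  then have "invertible S"
    by (meson invertible_left_inverse matrix_left_invertible_ker)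
  then show "S ** matrix_inv S = mat 1" "matrix_inv S ** S = mat 1"
    by (auto simp: invertible_def matrix_inv_def intro: someI2_ex)
qed

lemma eils_closed_form_unique_minimizer:
  fixes A :: "real^'n^'m" and B :: "real^'n^'s" and J :: "real^'m^'m"
    and b :: "real^'m" and d :: "real^'s" and y :: "real^'n"
  assumes J: "transpose J = J"
  assumes M_def: "M = transpose A ** J ** A"
  assumes N_def: "N = B ** matrix_inv M ** transpose B"
  assumes P_def: "P = transpose B ** matrix_inv N ** B ** matrix_inv M - mat 1"
  assumes M: "pos_def M" and B: "rank B = CARD('s)"
  defines x_def: "x \<equiv> matrix_inv M *v (transpose B *v (matrix_inv N *v d))
             - transpose P *v (matrix_inv M *v (transpose A *v (J *v b)))"
  shows "eils_minimizer J A B b d y \<longleftrightarrow> y = x"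
proof -
  note [simp del] = transpose_matrix_vector and MI = pos_def_inv[OF M]
  let ?M = "matrix_inv M" and ?N = "matrix_inv N"
  have adj: "u \<bullet> (X *v v) = (transpose X *v u) \<bullet> v" for u v and X :: "real^'i^'j"
    by (simp add: dot_lmul_matrix transpose_matrix_vector)
  have transpose_diff: "transpose (X - Y) = transpose X - transpose Y" for X Y :: "real^'i^'j"
    by (simp add: transpose_def vec_eq_iff)
  have symM: "transpose M = M"
    using M by (simp add: pos_def_def)
  have symMi: "transpose ?M = ?M"
  proof -
    have "transpose (M ** ?M) = mat 1"
      by (simp add: MI transpose_mat)
    then have "transpose ?M ** M = mat 1"
      by (simp add: matrix_transpose_mul symM)
    then have "transpose ?M ** (M ** ?M) = ?M"
      by (simp add: matrix_mul_assoc)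
    then show ?thesis
      by (simp add: MI)
  qed
  have N: "pos_def N"
    unfolding pos_def_def
  proof (intro conjI allI impI)
    show "transpose N = N"
      by (simp add: N_def matrix_transpose_mul symMi matrix_mul_assoc)
    fix v :: "real^'s" assume "v \<noteq> 0"
    have "inj ((*v) (transpose B))"
      using B by (simp flip: full_rank_injective add: rank_transpose)
    then have "transpose B *v v \<noteq> 0"
      using \<open>v \<noteq> 0\<close> by (metis inj_eq matrix_vector_mult_0_right)
    define w where "w = ?M *v (transpose B *v v)"
    have Mw: "M *v w = transpose B *v v"
      by (simp add: w_def matrix_vector_mul_assoc MI matrix_mul_assoc)
    then have "w \<noteq> 0"
      using \<open>transpose B *v v \<noteq> 0\<close> by auto
    then have "0 < w \<bullet> (M *v w)"
      using M by (simp add: pos_def_def)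
    also have "\<dots> = v \<bullet> (N *v v)"
      unfolding Mw
      by (simp add: N_def w_def matrix_vector_mul_assoc[symmetric] adj[of v B] inner_commute)
    finally show "0 < v \<bullet> (N *v v)" .
  qed
  note NI = pos_def_inv[OF N]
  have symNi: "transpose ?N = ?N"
  proof -
    have "transpose (N ** ?N) = mat 1"
      by (simp add: NI transpose_mat)
    then have "transpose ?N ** N = mat 1"
      using N by (simp add: matrix_transpose_mul pos_def_def)
    then have "transpose ?N ** (N ** ?N) = ?N"
      by (simp add: matrix_mul_assoc)
    then show ?thesis
      by (simp add: NI)
  qed
  define g where "g = transpose A *v (J *v b)"
  define l where "l = ?N *v d - ?N *v (B *v (?M *v g))"
  have PT: "transpose P = ?M ** transpose B ** ?N ** B - mat 1"
    unfolding P_def transpose_diff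
    by (simp add: matrix_transpose_mul symMi symNi transpose_mat matrix_mul_assoc)
  have x: "x = ?M *v (g + transpose B *v l)"
    by (simp add: x_def PT g_def[symmetric] l_def algebra_simps
        matrix_vector_mul_assoc[symmetric] matrix_vector_mult_diff_rdistrib
        matrix_vector_mult_diff_distrib matrix_vector_right_distrib)
  have Mx: "M *v x = g + transpose B *v l"
    unfolding x by (simp add: matrix_vector_mul_assoc MI)
  have "B *v x = B *v (?M *v g) + N *v l"
    by (simp add: x N_def matrix_vector_right_distrib matrix_vector_mul_assoc[symmetric])
  also have "N *v l = d - B *v (?M *v g)"
    by (simp add: l_def matrix_vector_mult_diff_distrib matrix_vector_mul_assoc matrix_mul_assoc NI)
  finally have Bx: "B *v x = d"
    by simp
  have key: "eils_objective J A b z = eils_objective J A b x + (z - x) \<bullet> (M *v (z - x))"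
    if z: "B *v z = d" for z
  proof -
    define h where "h = z - x"
    have zh: "z = x + h"
      by (simp add: h_def)
    have Bh: "B *v h = 0"
      by (simp add: h_def matrix_vector_mult_diff_distrib z Bx)
    define r where "r = b - A *v x"
    have r: "b - A *v z = r - A *v h"
      by (simp add: r_def zh matrix_vector_right_distrib)
    have "transpose A *v (J *v r) = g - M *v x"
      by (simp add: r_def g_def M_def matrix_vector_mult_diff_distrib matrix_vector_mul_assoc
          matrix_mul_assoc)
    then have "(J *v r) \<bullet> (A *v h) = - ((transpose B *v l) \<bullet> h)"
      by (simp add: Mx adj[of "J *v r" A h])
    also have "\<dots> = 0"
      by (simp add: adj[of l B h, symmetric] Bh)
    finally have 1: "(A *v h) \<bullet> (J *v r) = 0"
      by (simp add: inner_commute)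
    have 2: "r \<bullet> (J *v (A *v h)) = 0"
      unfolding adj[of r J] J using 1 by (simp add: inner_commute)
    have 3: "(A *v h) \<bullet> (J *v (A *v h)) = h \<bullet> (M *v h)"
      using adj[of "J *v (A *v h)" A h]
      by (simp add: M_def matrix_vector_mul_assoc[symmetric] inner_commute)
    show ?thesis
      unfolding eils_objective_def r r_def[symmetric] h_def[symmetric]
      by (simp add: matrix_vector_mult_diff_distrib inner_diff_left inner_diff_right 1 2 3)
  qed
  have M0: "0 < v \<bullet> (M *v v)" if "v \<noteq> 0" for v
    using M that by (simp add: pos_def_def)
  show ?thesis
  proof
    assume "eils_minimizer J A B b d y"
    then have "B *v y = d" "eils_objective J A b y \<le> eils_objective J A b x"
      using Bx by (auto simp: eils_minimizer_def is_arg_min_linorder)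
    then show "y = x"
      using key[of y] M0[of "y - x"] by fastforce
  next
    assume "y = x"
    moreover have "eils_objective J A b x \<le> eils_objective J A b z" if "B *v z = d" for z
      using key[OF that] M0[of "z - x"] by (cases "z = x") auto
    ultimately show "eils_minimizer J A B b d y"
      using Bx by (auto simp: eils_minimizer_def is_arg_min_linorder)
  qed
qed

lemma eils_solution_closed_form:
  fixes A :: "real^'n^'m" and B :: "real^'n^'s" and J :: "real^'m^'m"
  assumes "transpose J = J"
  assumes "M = transpose A ** J ** A"
  assumes "N = B ** matrix_inv M ** transpose B"
  assumes "P = transpose B ** matrix_inv N ** B ** matrix_inv M - mat 1"
  assumes "pos_def M" and "rank B = CARD('s)"
  shows "eils_solution J A B b d = matrix_inv M *v (transpose B *v (matrix_inv N *v d))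
             - transpose P *v (matrix_inv M *v (transpose A *v (J *v b)))"
  using eils_closed_form_unique_minimizer[OF assms] by (simp add: eils_solution_def)

text \<open>
  Supremum of the difference quotients over all perturbations with \<open>0 < \<parallel>\<rho> \<circ> \<Delta>\<parallel>\<^sub>\<mu> \<le> \<delta>\<close>, for a
  map \<open>F\<close> on the data. It is extended real valued, because it may be infinite when \<open>\<delta>\<close> is large.
\<close>

definition cond_quotient_sup ::
    "(real^('n \<times> 'm + 'n \<times> 's + 'm + 's) \<Rightarrow> real) \<Rightarrow> (real^'k \<Rightarrow> real) \<Rightarrow> real^'k \<Rightarrow>
     real^'n^'m \<Rightarrow> real^'n^'s \<Rightarrow> real^'m \<Rightarrow> real^'s \<Rightarrow>
     (real^'n^'m \<Rightarrow> real^'n^'s \<Rightarrow> real^'m \<Rightarrow> real^'s \<Rightarrow> real^'k) \<Rightarrow>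
     real^'n^'m \<Rightarrow> real^'n^'s \<Rightarrow> real^'m \<Rightarrow> real^'s \<Rightarrow> real \<Rightarrow> ereal" where
  "cond_quotient_sup \<eta> \<nu> \<xi> \<Phi> \<Psi> \<beta> \<theta> F A B b d \<delta> =
     (SUP (dA, dB, db, dd) \<in> {(dA, dB, db, dd).
            0 < \<eta> (data_vec (\<Phi> * dA) (\<Psi> * dB) (\<beta> * db) (\<theta> * dd)) \<and>
            \<eta> (data_vec (\<Phi> * dA) (\<Psi> * dB) (\<beta> * db) (\<theta> * dd)) \<le> \<delta>}.
        ereal (\<nu> (\<xi> * (F (A + dA) (B + dB) (b + db) (d + dd) - F A B b d))
               / \<eta> (data_vec (\<Phi> * dA) (\<Psi> * dB) (\<beta> * db) (\<theta> * dd))))"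

definition projected_cond ::
    "(real^('n \<times> 'm + 'n \<times> 's + 'm + 's) \<Rightarrow> real) \<Rightarrow> (real^'k \<Rightarrow> real) \<Rightarrow> real^'k \<Rightarrow>
     real^'n^'m \<Rightarrow> real^'n^'s \<Rightarrow> real^'m \<Rightarrow> real^'s \<Rightarrow>
     (real^'n^'m \<Rightarrow> real^'n^'s \<Rightarrow> real^'m \<Rightarrow> real^'s \<Rightarrow> real^'k) \<Rightarrow>
     real^'n^'m \<Rightarrow> real^'n^'s \<Rightarrow> real^'m \<Rightarrow> real^'s \<Rightarrow> ereal" where
  "projected_cond \<eta> \<nu> \<xi> \<Phi> \<Psi> \<beta> \<theta> F A B b d =
     Lim (at_right 0) (cond_quotient_sup \<eta> \<nu> \<xi> \<Phi> \<Psi> \<beta> \<theta> F A B b d)"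

definition projected_solution ::
    "real^'k^'n \<Rightarrow> real^'m^'m \<Rightarrow>
     real^'n^'m \<Rightarrow> real^'n^'s \<Rightarrow> real^'m \<Rightarrow> real^'s \<Rightarrow> real^'k" where
  "projected_solution L J A B b d = transpose L *v eils_solution J A B b d"

end

theory Submission
  imports Defs
begin

text \<open>
  Write the optimality conditions as \<open>A\<^sup>TJr + B\<^sup>T\<lambda> = 0\<close>, \<open>Bx = d\<close>. Subtracting them from the
  conditions for the perturbed data gives a saddle point system for \<open>x' - x\<close> and
  \<open>\<lambda>' - \<lambda>\<close> with the unperturbed matrices, whose right-hand side is linear in the
  perturbation, with coefficients depending on the perturbed \<open>x'\<close>, \<open>r'\<close> and \<open>\<lambda>'\<close>. Solving it gives an
  exact formula for \<open>x' - x\<close>; since \<open>x'\<close>, \<open>r'\<close> and \<open>\<lambda>'\<close> depend continuously on the data, the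
  Frechet derivative is obtained by replacing them with \<open>x\<close>, \<open>r\<close> and \<open>\<lambda>\<close>. The condition
  number of a differentiable map is the induced norm of its derivative, as all norms are
  equivalent in finite dimension.
\<close>

subsection \<open>Continuity of the matrix inverse and open conditions on matrices\<close>

lemma bounded_bilinear_matrix_vector_mult:
  "bounded_bilinear ((*v) :: real^'n^'m \<Rightarrow> real^'n \<Rightarrow> real^'m)"
  unfolding bilinear_conv_bounded_bilinear[symmetric] bilinear_def linear_iff
  by (simp add: algebra_simps scaleR_matrix_vector_assoc)

lemma bounded_bilinear_matrix_mult:
  "bounded_bilinear ((**) :: real^'n^'m \<Rightarrow> real^'k^'n \<Rightarrow> real^'k^'m)"
  unfolding bilinear_conv_bounded_bilinear[symmetric] bilinear_def linear_iff
  by (auto simp: vec_eq_iff matrix_matrix_mult_def sum.distrib sum_distrib_left algebra_simps)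

lemma bounded_linear_transpose: "bounded_linear (transpose :: real^'n^'m \<Rightarrow> real^'m^'n)"
  unfolding linear_conv_bounded_linear[symmetric] linear_iff
  by (simp add: transpose_def vec_eq_iff)

lemmas tendsto_matrix_vector_mult = bounded_bilinear.tendsto[OF bounded_bilinear_matrix_vector_mult]
lemmas tendsto_matrix_mult = bounded_bilinear.tendsto[OF bounded_bilinear_matrix_mult]
lemmas tendsto_transpose = bounded_linear.tendsto[OF bounded_linear_transpose]

lemma tendsto_det:
  fixes f :: "'a \<Rightarrow> real^'n^'n"
  assumes "(f \<longlongrightarrow> X) F"
  shows "((\<lambda>z. det (f z)) \<longlongrightarrow> det X) F"
  unfolding det_def by (intro tendsto_intros assms)

lemma matrix_inv_right:
  fixes X :: "real^'n^'n"
  assumes "det X \<noteq> 0"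
  shows "X ** matrix_inv X = mat 1"
  using assms unfolding invertible_det_nz[symmetric] invertible_def matrix_inv_def
  by (auto intro: someI2_ex)

text \<open>The columns of the inverse solve the linear systems with unit vectors as right-hand
  sides, so Cramer's rule applies to each of them. In this form continuity of the inverse can be
  read off from that of the determinant.\<close>

lemma matrix_inv_cramer:
  fixes X :: "real^'n^'n"
  assumes "det X \<noteq> 0"
  shows "matrix_inv X = (\<chi> k l. det (\<chi> i j. if j = k then axis l 1 $ i else X $ i $ j) / det X)"
proof -
  have "X ** matrix_inv X = mat 1"
    using assms by (rule matrix_inv_right)
  then have "X *v (matrix_inv X *v axis l 1) = axis l 1" for l
    by (simp add: matrix_vector_mul_assoc)
  then have "column l (matrix_inv X) = (\<chi> k. det (\<chi> i j. if j = k then axis l 1 $ i else X $ i $ j) / det X)" for l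
    unfolding cramer[OF assms] by (simp add: matrix_vector_mult_basis)
  then show ?thesis
    by (simp add: vec_eq_iff column_def)
qed

text \<open>The quotients in Cramer's rule converge because the limit of their denominators is
  nonzero. They represent the inverse only where \<open>f z\<close> is nonsingular, which is the
  case eventually.\<close>

lemma tendsto_matrix_inv:
  fixes f :: "'a \<Rightarrow> real^'n^'n"
  assumes f: "(f \<longlongrightarrow> X) F" and X: "det X \<noteq> 0"
  shows "((\<lambda>z. matrix_inv (f z)) \<longlongrightarrow> matrix_inv X) F"
proof (rule Lim_transform_eventually)
  have "\<forall>\<^sub>F z in F. det (f z) \<noteq> 0"
    using tendsto_det[OF f] X by (rule tendsto_imp_eventually_ne)
  then show "\<forall>\<^sub>F z in F. (\<chi> k l. det (\<chi> i j. if j = k then axis l 1 $ i else f z $ i $ j) / det (f z))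
      = matrix_inv (f z)"
    by eventually_elim (simp add: matrix_inv_cramer)
  have "((\<lambda>z. if j = k then c else f z $ i $ j) \<longlongrightarrow> (if j = k then c else X $ i $ j)) F" for i j k c
    using f by (auto intro: tendsto_intros)
  then show "((\<lambda>z. \<chi> k l. det (\<chi> i j. if j = k then axis l 1 $ i else f z $ i $ j) / det (f z))
      \<longlongrightarrow> matrix_inv X) F"
    unfolding matrix_inv_cramer[OF X]
    by (intro tendsto_vec_lambda tendsto_divide tendsto_det f X)
qed

lemma pos_def_det: "pos_def S \<Longrightarrow> det S \<noteq> 0"
  using pos_def_inv invertible_det_nz invertible_def by metis

text \<open>By compactness the quadratic form of \<open>S\<close> has a positive minimum on the unit
  sphere, and a small perturbation changes the form there by less than this minimum. Symmetry is not
  an open condition, hence the hypothesis on every \<open>f z\<close>.\<close>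

lemma eventually_pos_def:
  fixes f :: "'a \<Rightarrow> real^'n^'n"
  assumes f: "(f \<longlongrightarrow> S) F" and S: "pos_def S" and sym: "\<And>z. transpose (f z) = f z"
  shows "\<forall>\<^sub>F z in F. pos_def (f z)"
proof -
  have ne: "sphere (0 :: real^'n) 1 \<noteq> {}"
    by simp
  have cont: "continuous_on (sphere 0 1) (\<lambda>v. v \<bullet> (S *v v))"
    by (intro continuous_intros)
  obtain u where u: "u \<in> sphere 0 1" and min: "\<And>v. v \<in> sphere 0 1 \<Longrightarrow> u \<bullet> (S *v u) \<le> v \<bullet> (S *v v)"
    using continuous_attains_inf[OF compact_sphere ne cont] by blast
  define c where "c = u \<bullet> (S *v u)"
  have "u \<noteq> 0"
    using u by auto
  then have c: "0 < c"
    using S by (auto simp: c_def pos_def_def)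
  obtain K where K: "0 < K" and bound: "\<And>(X :: real^'n^'n) v. norm (X *v v) \<le> norm X * norm v * K"
    using bounded_bilinear.pos_bounded[OF bounded_bilinear_matrix_vector_mult] by blast
  have "\<forall>\<^sub>F z in F. dist (f z) S < c / K"
    using f c K by (simp add: tendstoD)
  then show ?thesis
  proof eventually_elim
    case (elim z)
    have pos: "0 < v \<bullet> (f z *v v)" if v: "norm v = 1" for v
    proof -
      have "\<bar>v \<bullet> ((f z - S) *v v)\<bar> \<le> norm v * norm ((f z - S) *v v)"
        by (rule Cauchy_Schwarz_ineq2)
      also have "\<dots> \<le> norm (f z - S) * K"
        using bound[of "f z - S" v] v by simp
      also have "\<dots> < c"
        using elim K by (simp add: dist_norm field_simps)
      also have "c \<le> v \<bullet> (S *v v)"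
        using min[of v] v by (simp add: c_def)
      finally show ?thesis
        by (simp add: matrix_vector_mult_diff_rdistrib inner_diff_right)
    qed
    show ?case
      unfolding pos_def_def
    proof (intro conjI allI impI)
      fix v :: "real^'n" assume "v \<noteq> 0"
      then have "0 < (v /\<^sub>R norm v) \<bullet> (f z *v (v /\<^sub>R norm v))"
        by (intro pos) simp
      then show "0 < v \<bullet> (f z *v v)"
        using \<open>v \<noteq> 0\<close> by (simp add: matrix_vector_mult_scaleR zero_less_mult_iff)
    qed (rule sym)
  qed
qed

text \<open>The kernels of \<open>X ** transpose X\<close> and \<open>transpose X\<close> agree,
  since the quadratic form of the Gram matrix at \<open>v\<close> is the squared length of
  \<open>transpose X *v v\<close>. This turns full row rank into the nonvanishing of a continuous
  function.\<close>

lemma rank_eq_rows_iff_det_gram: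
  fixes X :: "real^'n^'s"
  shows "rank X = CARD('s) \<longleftrightarrow> det (X ** transpose X) \<noteq> 0"
proof -
  have "(\<forall>v. (X ** transpose X) *v v = 0 \<longrightarrow> v = 0) \<longleftrightarrow> (\<forall>v. transpose X *v v = 0 \<longrightarrow> v = 0)"
  proof -
    have "transpose X *v v = 0" if "(X ** transpose X) *v v = 0" for v
    proof -
      have "(transpose X *v v) \<bullet> (transpose X *v v) = v \<bullet> (X *v (transpose X *v v))"
        by (metis dot_lmul_matrix inner_commute transpose_matrix_vector)
      then show ?thesis
        using that by (simp add: matrix_vector_mul_assoc del: transpose_matrix_vector)
    qed
    then show ?thesis
      by (metis matrix_vector_mul_assoc matrix_vector_mult_0_right)
  qed
  also have "\<dots> \<longleftrightarrow> rank X = CARD('s)"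
    by (metis full_rank_injective matrix_left_invertible_injective matrix_left_invertible_ker rank_transpose)
  finally show ?thesis
    by (metis invertible_det_nz invertible_left_inverse matrix_left_invertible_ker)
qed

lemma eventually_full_row_rank:
  fixes f :: "'a \<Rightarrow> real^'n^'s"
  assumes f: "(f \<longlongrightarrow> X) F" and X: "rank X = CARD('s)"
  shows "\<forall>\<^sub>F z in F. rank (f z) = CARD('s)"
  using X unfolding rank_eq_rows_iff_det_gram
  by (rule tendsto_imp_eventually_ne[OF tendsto_det[OF tendsto_matrix_mult[OF f tendsto_transpose[OF f]]]])

subsection \<open>Difference quotients with respect to vector norms\<close>

lemma vector_norm_bound:
  fixes \<mu> :: "'a::euclidean_space \<Rightarrow> real"
  assumes "vector_norm \<mu>"
  obtains C where "0 < C" "\<And>z. \<mu> z \<le> C * norm z"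
proof
  have tri: "\<mu> (u + v) \<le> \<mu> u + \<mu> v" and scale: "\<mu> (c *\<^sub>R v) = \<bar>c\<bar> * \<mu> v"
    and nonneg: "0 \<le> \<mu> v" and zero: "\<mu> 0 = 0" for u v c
    using assms by (auto simp: vector_norm_def)
  \<comment> \<open>The summand 1 makes \<open>C\<close> positive without an appeal to
    definiteness.\<close>
  define C where "C = (\<Sum>i\<in>Basis. \<mu> i) + 1"
  show "0 < C"
    unfolding C_def by (intro add_nonneg_pos sum_nonneg nonneg) simp
  fix z :: 'a
  have sum: "\<mu> (\<Sum>i\<in>I. g i) \<le> (\<Sum>i\<in>I. \<mu> (g i))" if "finite I" for I and g :: "'a \<Rightarrow> 'a"
    using that by (induction I) (auto simp: zero intro: order_trans[OF tri])
  have "\<mu> z = \<mu> (\<Sum>i\<in>Basis. (z \<bullet> i) *\<^sub>R i)"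
    by (simp add: euclidean_representation)
  also have "\<dots> \<le> (\<Sum>i\<in>Basis. \<bar>z \<bullet> i\<bar> * \<mu> i)"
    using sum[of Basis "\<lambda>i. (z \<bullet> i) *\<^sub>R i"] by (simp add: scale)
  also have "\<dots> \<le> (\<Sum>i\<in>Basis. norm z * \<mu> i)"
    by (intro sum_mono mult_right_mono Basis_le_norm nonneg)
  also have "\<dots> \<le> C * norm z"
    by (simp add: C_def sum_distrib_left[symmetric] algebra_simps)
  finally show "\<mu> z \<le> C * norm z" .
qed

text \<open>The upper bound makes \<mu> Lipschitz, so it attains a minimum on the compact unit
  sphere. Definiteness makes this minimum positive, and homogeneity extends the estimate to all
  vectors.\<close>

lemma norm_bound_vector_norm:
  fixes \<mu> :: "'a::euclidean_space \<Rightarrow> real"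
  assumes \<mu>: "vector_norm \<mu>"
  obtains c where "0 < c" "\<And>z. norm z \<le> c * \<mu> z"
proof -
  have tri: "\<mu> (u + v) \<le> \<mu> u + \<mu> v" and scale: "\<mu> (c *\<^sub>R v) = \<bar>c\<bar> * \<mu> v"
    and nonneg: "0 \<le> \<mu> v" and zero: "\<mu> v = 0 \<longleftrightarrow> v = 0" for u v c
    using \<mu> by (auto simp: vector_norm_def)
  obtain C where C: "0 < C" "\<And>z. \<mu> z \<le> C * norm z"
    using vector_norm_bound[OF \<mu>] by blast
  have "\<bar>\<mu> u - \<mu> v\<bar> \<le> C * norm (u - v)" for u v
    using tri[of "u - v" v] tri[of "v - u" u] C(2)[of "u - v"] C(2)[of "v - u"]
    by (simp add: norm_minus_commute)
  then have "C-lipschitz_on UNIV \<mu>"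
    using C(1) by (auto simp: lipschitz_on_def dist_norm)
  then have cont: "continuous_on (sphere 0 1) \<mu>"
    using lipschitz_on_continuous_on continuous_on_subset by blast
  obtain u where u: "u \<in> sphere 0 1" and min: "\<And>v. v \<in> sphere 0 1 \<Longrightarrow> \<mu> u \<le> \<mu> v"
    using continuous_attains_inf[OF compact_sphere _ cont] by auto
  have "\<mu> u \<noteq> 0"
    using u by (auto simp: zero)
  then have pos: "0 < \<mu> u"
    using nonneg[of u] by simp
  show thesis
  proof
    show "0 < 1 / \<mu> u"
      using pos by simp
    fix z :: 'a
    show "norm z \<le> 1 / \<mu> u * \<mu> z"
    proof (cases "z = 0")
      case False
      then have "\<mu> u \<le> \<mu> (z /\<^sub>R norm z)"
        by (intro min) simp
      then show ?thesis
        using False pos by (simp add: scale field_simps)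
    qed (simp add: nonneg)
  qed
qed

text \<open>A supremum of reals is an upper bound only for a bounded set; this makes the induced
  norm usable as one.\<close>

lemma bdd_above_vector_norm_quotients:
  fixes D :: "'a::euclidean_space \<Rightarrow> 'b::euclidean_space"
  assumes D: "bounded_linear D" and \<mu>: "vector_norm \<mu>" and \<nu>: "vector_norm \<nu>"
  shows "bdd_above ((\<lambda>z. \<nu> (D z) / \<mu> z) ` {z. z \<noteq> 0})"
proof -
  obtain C where C: "0 < C" "\<And>z. \<nu> z \<le> C * norm z"
    using vector_norm_bound[OF \<nu>] by blast
  obtain c where c: "0 < c" "\<And>z. norm z \<le> c * \<mu> z"
    using norm_bound_vector_norm[OF \<mu>] by blast
  obtain K where K: "0 < K" "\<And>z. norm (D z) \<le> norm z * K"
    using bounded_linear.pos_bounded[OF D] by blast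
  have "\<nu> (D z) / \<mu> z \<le> C * (c * K)" if "z \<noteq> 0" for z
  proof -
    have "0 < \<mu> z"
      using \<mu> that by (metis less_eq_real_def vector_norm_def)
    have "\<nu> (D z) \<le> C * (norm z * K)"
      using C(2)[of "D z"] K(2)[of z] C(1) by (meson mult_left_mono order_trans less_imp_le)
    also have "\<dots> \<le> C * (c * \<mu> z * K)"
      using c(2)[of z] C(1) K(1) by (intro mult_left_mono mult_right_mono) auto
    finally show ?thesis
      using \<open>0 < \<mu> z\<close> by (simp add: field_simps)
  qed
  then show ?thesis
    by (intro bdd_aboveI2) auto
qed

text \<open>For small \<delta> the remainder contributes at most \<open>e\<close> to any quotient,
  which bounds the supremum from above. For the bound from below, every direction can be rescaled to
  \<mu>-length exactly \<delta>, and quotients of the linear map \<open>D\<close> are invariant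
  under scaling.\<close>

lemma tendsto_SUP_vector_norm_difference_quotient:
  fixes G :: "'a::euclidean_space \<Rightarrow> 'b::euclidean_space"
  assumes G: "(G has_derivative D) (at 0)" and \<mu>: "vector_norm \<mu>" and \<nu>: "vector_norm \<nu>"
  shows "((\<lambda>\<delta>. SUP z\<in>{z. 0 < \<mu> z \<and> \<mu> z \<le> \<delta>}. ereal (\<nu> (G z - G 0) / \<mu> z))
    \<longlongrightarrow> ereal (SUP z\<in>{z. z \<noteq> 0}. \<nu> (D z) / \<mu> z)) (at_right 0)"
proof -
  define K where "K = (SUP z\<in>{z. z \<noteq> 0}. \<nu> (D z) / \<mu> z)"
  define Q where "Q \<delta> = (SUP z\<in>{z. 0 < \<mu> z \<and> \<mu> z \<le> \<delta>}. ereal (\<nu> (G z - G 0) / \<mu> z))" for \<delta>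
  have D: "bounded_linear D"
    using G by (rule has_derivative_bounded_linear)
  have scale: "\<mu> (c *\<^sub>R v) = \<bar>c\<bar> * \<mu> v" and nonneg: "0 \<le> \<mu> v" and zero: "\<mu> v = 0 \<longleftrightarrow> v = 0" for v c
    using \<mu> by (auto simp: vector_norm_def)
  have tri': "\<nu> (u + v) \<le> \<nu> u + \<nu> v" and scale': "\<nu> (c *\<^sub>R v) = \<bar>c\<bar> * \<nu> v" for u v c
    using \<nu> by (auto simp: vector_norm_def)
  obtain C where C: "0 < C" "\<And>z. \<nu> z \<le> C * norm z"
    using vector_norm_bound[OF \<nu>] by blast
  obtain c where c: "0 < c" "\<And>z. norm z \<le> c * \<mu> z"
    using norm_bound_vector_norm[OF \<mu>] by blast
  have DK: "\<nu> (D z) / \<mu> z \<le> K" if "z \<noteq> 0" for z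
    unfolding K_def using that
    by (intro cSUP_upper bdd_above_vector_norm_quotients D \<mu> \<nu>) auto
  have bounds: "\<forall>\<^sub>F \<delta> in at_right 0. Q \<delta> \<le> ereal (K + e) \<and> ereal (K - e) \<le> Q \<delta>" if e: "0 < e" for e
  proof -
    \<comment> \<open>Passing from \<nu> to the Euclidean norm costs \<open>C\<close>, and from
      there to \<mu> costs \<open>c\<close>; this tolerance leaves exactly
      \<open>e * \<mu> z\<close>.\<close>
    have e': "0 < e / (C * c)"
      using e C c by simp
    obtain t where t: "0 < t"
      "\<And>z. norm z < t \<Longrightarrow> norm (G z - G 0 - D z) \<le> e / (C * c) * norm z"
      using G e' unfolding has_derivative_at_alt by (metis diff_zero)
    have rem: "\<nu> (G z - G 0 - D z) \<le> e * \<mu> z" if "\<mu> z < t / c" for z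
    proof -
      have "norm z \<le> c * \<mu> z"
        by (rule c)
      also have "\<dots> < t"
        using that c(1) by (simp add: field_simps)
      finally have "norm (G z - G 0 - D z) \<le> e / (C * c) * norm z"
        by (rule t)
      also have "\<dots> \<le> e / (C * c) * (c * \<mu> z)"
        using e' by (intro mult_left_mono c) auto
      also have "\<dots> = e * \<mu> z / C"
        using c(1) by simp
      finally have "C * norm (G z - G 0 - D z) \<le> e * \<mu> z"
        using C(1) by (simp add: field_simps)
      then show ?thesis
        using C(2) order_trans by blast
    qed
    have neg: "\<nu> (- v) = \<nu> v" for v
      using scale'[of "-1" v] by simp
    have main: "Q \<delta> \<le> ereal (K + e) \<and> ereal (K - e) \<le> Q \<delta>" if \<delta>: "0 < \<delta>" "\<delta> < t / c" for \<delta>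
    proof
      show "Q \<delta> \<le> ereal (K + e)"
        unfolding Q_def
      proof (rule SUP_least)
        fix z assume "z \<in> {z. 0 < \<mu> z \<and> \<mu> z \<le> \<delta>}"
        then have z: "0 < \<mu> z" "\<mu> z < t / c" "z \<noteq> 0"
          using \<delta> by (auto simp flip: zero)
        have "\<nu> (G z - G 0) \<le> \<nu> (D z) + e * \<mu> z"
          using tri'[of "D z" "G z - G 0 - D z"] rem[OF z(2)] by simp
        then have "\<nu> (G z - G 0) / \<mu> z \<le> \<nu> (D z) / \<mu> z + e"
          using z(1) by (simp add: field_simps)
        then show "ereal (\<nu> (G z - G 0) / \<mu> z) \<le> ereal (K + e)"
          using DK[OF z(3)] by simp
      qed
      \<comment> \<open>The multiple \<open>s *\<^sub>R z\<close> lies on the \<mu>-sphere of radius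
        \<delta>, so it is admissible in the supremum.\<close>
      have "\<nu> (D z) / \<mu> z - e \<le> \<nu> (G (s *\<^sub>R z) - G 0) / \<mu> (s *\<^sub>R z)
          \<and> s *\<^sub>R z \<in> {z. 0 < \<mu> z \<and> \<mu> z \<le> \<delta>}"
        if z: "z \<noteq> 0" and s: "s = \<delta> / \<mu> z" for z s
      proof -
        have \<mu>z: "0 < \<mu> z"
          using z nonneg[of z] zero[of z] by linarith
        have sz: "\<mu> (s *\<^sub>R z) = \<delta>"
          using \<mu>z \<delta> by (simp add: scale s)
        have "\<nu> (D (s *\<^sub>R z)) = s * \<nu> (D z)"
          using \<delta> \<mu>z by (simp add: scale' s linear_cmul bounded_linear.linear[OF D])
        moreover have "\<nu> (D (s *\<^sub>R z)) \<le> \<nu> (G (s *\<^sub>R z) - G 0) + e * \<delta>"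
          using tri'[of "G (s *\<^sub>R z) - G 0" "- (G (s *\<^sub>R z) - G 0 - D (s *\<^sub>R z))"]
            rem[of "s *\<^sub>R z"] \<delta>
          unfolding neg by (simp add: sz)
        ultimately have "\<nu> (D z) / \<mu> z - e \<le> \<nu> (G (s *\<^sub>R z) - G 0) / \<delta>"
          using \<delta> by (simp add: s field_simps)
        then show ?thesis
          using \<delta> by (simp add: sz)
      qed
      then have low: "ereal (\<nu> (D z) / \<mu> z - e) \<le> Q \<delta>" if "z \<noteq> 0" for z
        unfolding Q_def using that by (intro SUP_upper2) auto
      \<comment> \<open>With \<open>e\<close> on the right, a finite \<open>Q \<delta>\<close>
        reduces the claim to a bound on the real supremum \<open>K\<close>. The value minus infinity
        is excluded by any nonzero vector.\<close>
      have "ereal K \<le> Q \<delta> + ereal e"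
      proof (cases "Q \<delta>")
        case (real y)
        have "K \<le> y + e"
          unfolding K_def
        proof (rule cSUP_least)
          show "{z :: 'a. z \<noteq> 0} \<noteq> {}"
            using nonempty_Basis nonzero_Basis by blast
          fix z :: 'a assume "z \<in> {z. z \<noteq> 0}"
          then show "\<nu> (D z) / \<mu> z \<le> y + e"
            using low[of z] real by auto
        qed
        then show ?thesis
          by (simp add: real)
      next
        case MInf
        obtain z :: 'a where "z \<noteq> 0"
          using nonempty_Basis nonzero_Basis by blast
        then show ?thesis
          using low[of z] MInf by simp
      qed simp
      then show "ereal (K - e) \<le> Q \<delta>"
        by (cases "Q \<delta>") auto
    qed
    have "0 < t / c"
      using t c by simp
    then show ?thesis
      unfolding eventually_at_right_field using main by blast
  qed
  have "(Q \<longlongrightarrow> ereal K) (at_right 0)"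
  proof (rule order_tendstoI)
    fix a assume "a < ereal K"
    then obtain y where y: "a < ereal y" "y < K"
      using ereal_dense2 by (metis less_ereal.simps(1))
    show "\<forall>\<^sub>F \<delta> in at_right 0. a < Q \<delta>"
      using bounds[of "K - y"] y by (auto elim: eventually_mono order_less_le_trans)
  next
    fix a assume "ereal K < a"
    then obtain y where y: "ereal y < a" "K < y"
      using ereal_dense2 by (metis less_ereal.simps(1))
    show "\<forall>\<^sub>F \<delta> in at_right 0. Q \<delta> < a"
      using bounds[of "y - K"] y by (auto elim: eventually_mono order_le_less_trans)
  qed
  then show ?thesis
    unfolding Q_def K_def .
qed

text \<open>With \<open>S\<close> the weighting and stacking of a perturbation, this makes its
  weighted size a norm on the space of data quadruples.\<close>

lemma vector_norm_comp_linear: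
  assumes \<eta>: "vector_norm \<eta>" and S: "linear S" and ker: "\<And>z. S z = 0 \<Longrightarrow> z = 0"
  shows "vector_norm (\<lambda>z. \<eta> (S z))"
  using \<eta> ker linear_0[OF S]
  by (auto simp: vector_norm_def linear_add[OF S] linear_cmul[OF S])

subsection \<open>Optimality conditions and the derivative of the solution map\<close>

context
  notes [simp del] = transpose_matrix_vector
begin

lemma inner_matrix_vector_mult: "u \<bullet> (X *v v) = (transpose X *v u) \<bullet> v" for X :: "real^'n^'m"
  by (simp add: dot_lmul_matrix transpose_matrix_vector)

lemma transpose_matrix_inv_pos_def:
  fixes S :: "real^'n^'n"
  assumes S: "pos_def S"
  shows "transpose (matrix_inv S) = matrix_inv S"
proof -
  have "transpose (S ** matrix_inv S) = mat 1"
    by (simp add: pos_def_inv[OF S] transpose_mat)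
  then have "transpose (matrix_inv S) ** S = mat 1"
    using S by (simp add: matrix_transpose_mul pos_def_def)
  then have "transpose (matrix_inv S) ** (S ** matrix_inv S) = matrix_inv S"
    by (simp add: matrix_mul_assoc)
  then show ?thesis
    by (simp add: pos_def_inv[OF S])
qed

text \<open>For \<open>w = matrix_inv M *v (transpose B *v v)\<close> the form at \<open>v\<close>
  equals the form of \<open>M\<close> at \<open>w\<close>, and \<open>w\<close> is nonzero because
  full row rank of \<open>B\<close> makes its transpose injective.\<close>

lemma pos_def_constraint_gram:
  fixes M :: "real^'n^'n" and B :: "real^'n^'s"
  assumes M: "pos_def M" and B: "rank B = CARD('s)"
  shows "pos_def (B ** matrix_inv M ** transpose B)"
  unfolding pos_def_def
proof (intro conjI allI impI)
  show "transpose (B ** matrix_inv M ** transpose B) = B ** matrix_inv M ** transpose B"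
    by (simp add: matrix_transpose_mul transpose_matrix_inv_pos_def[OF M] matrix_mul_assoc)
  fix v :: "real^'s" assume "v \<noteq> 0"
  have "inj ((*v) (transpose B))"
    using B by (simp flip: full_rank_injective add: rank_transpose)
  then have "transpose B *v v \<noteq> 0"
    using \<open>v \<noteq> 0\<close> by (metis inj_eq matrix_vector_mult_0_right)
  define w where "w = matrix_inv M *v (transpose B *v v)"
  have Mw: "M *v w = transpose B *v v"
    by (simp add: w_def matrix_vector_mul_assoc pos_def_inv[OF M] matrix_mul_assoc)
  then have "w \<noteq> 0"
    using \<open>transpose B *v v \<noteq> 0\<close> by auto
  then have "0 < w \<bullet> (M *v w)"
    using M by (simp add: pos_def_def)
  also have "\<dots> = v \<bullet> ((B ** matrix_inv M ** transpose B) *v v)"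
    unfolding Mw
    by (simp add: w_def matrix_vector_mul_assoc[symmetric] inner_matrix_vector_mult[of v B]
        inner_commute)
  finally show "0 < v \<bullet> ((B ** matrix_inv M ** transpose B) *v v)" .
qed

lemma transpose_diff: "transpose (X - Y) = transpose X - transpose Y" for X Y :: "real^'n^'m"
  by (simp add: transpose_def vec_eq_iff)

lemma transpose_add: "transpose (X + Y) = transpose X + transpose Y" for X Y :: "real^'n^'m"
  by (simp add: transpose_def vec_eq_iff)

context
  fixes M P :: "real^'n^'n" and B :: "real^'n^'s" and N :: "real^'s^'s"
  assumes N: "N = B ** matrix_inv M ** transpose B"
    and P: "P = transpose B ** matrix_inv N ** B ** matrix_inv M - mat 1"
    and M: "pos_def M" and B: "rank B = CARD('s)"
begin

lemma pos_def_N: "pos_def N"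
  unfolding N using M B by (rule pos_def_constraint_gram)

lemma transpose_P: "transpose P = matrix_inv M ** transpose B ** matrix_inv N ** B - mat 1"
  unfolding P transpose_diff
  by (simp add: matrix_transpose_mul transpose_matrix_inv_pos_def M pos_def_N transpose_mat
      matrix_mul_assoc)

text \<open>Expanding \<open>P\<close> gives the same symmetric matrix on both sides. The saddle
  point solution produces the left product, whereas \<open>Gam\<close> and \<open>Om\<close> contain
  the right one.\<close>

lemma transpose_P_mult_inv: "transpose P ** matrix_inv M = matrix_inv M ** P"
  unfolding matrix_eq transpose_P
  by (simp add: P matrix_vector_mul_assoc[symmetric] matrix_vector_mult_diff_rdistrib
      matrix_vector_mult_diff_distrib)

text \<open>Block elimination: solving the first equation for \<open>h\<close> and inserting it into
  the constraint gives a system with matrix \<open>N\<close> for the multiplier \<open>k\<close>,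
  which then drops out of the formula for \<open>h\<close>.\<close>

lemma saddle_point_solution:
  assumes h: "M *v h = g + transpose B *v k" and e: "B *v h = e"
  shows "h = matrix_inv M *v (transpose B *v (matrix_inv N *v e))
    - transpose P *v (matrix_inv M *v g)"
proof -
  have "matrix_inv M *v (M *v h) = h"
    by (simp add: matrix_vector_mul_assoc pos_def_inv[OF M])
  then have h': "h = matrix_inv M *v g + matrix_inv M *v (transpose B *v k)"
    unfolding h by (simp add: matrix_vector_right_distrib)
  have "e = B *v (matrix_inv M *v g) + N *v k"
    unfolding e[symmetric]
    by (subst h') (simp add: N matrix_vector_right_distrib matrix_vector_mul_assoc[symmetric])
  moreover have "matrix_inv N *v (N *v k) = k"
    by (simp add: matrix_vector_mul_assoc pos_def_inv[OF pos_def_N])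
  ultimately have k: "k = matrix_inv N *v e - matrix_inv N *v (B *v (matrix_inv M *v g))"
    by (simp add: matrix_vector_right_distrib)
  show ?thesis
    by (subst h') (simp add: k transpose_P matrix_vector_mul_assoc[symmetric]
        matrix_vector_mult_diff_rdistrib matrix_vector_mult_diff_distrib)
qed

end

text \<open>The closed form carries a multiplier \<open>l\<close> with
  \<open>M *v x = g + transpose B *v l\<close>, which is the stationarity condition. It remains to
  identify \<open>l\<close> with the explicit \<open>lam\<close>.\<close>

lemma eils_solution_kkt:
  fixes A :: "real^'n^'m" and B :: "real^'n^'s" and J :: "real^'m^'m"
  assumes J: "transpose J = J" and M: "pos_def (transpose A ** J ** A)" and B: "rank B = CARD('s)"
    and x: "x = eils_solution J A B b d"
    and lam: "lam = - (matrix_inv (B ** transpose B) *v (B *v (transpose A *v (J *v (b - A *v x)))))"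
  shows "B *v x = d" and "transpose A *v (J *v (b - A *v x)) + transpose B *v lam = 0"
proof -
  define M where "M = transpose A ** J ** A"
  define N where "N = B ** matrix_inv M ** transpose B"
  define P where "P = transpose B ** matrix_inv N ** B ** matrix_inv M - mat 1"
  define g where "g = transpose A *v (J *v b)"
  define l where "l = matrix_inv N *v d - matrix_inv N *v (B *v (matrix_inv M *v g))"
  have M': "pos_def M"
    using M by (simp add: M_def)
  note MI = pos_def_inv[OF M'] and NI = pos_def_inv[OF pos_def_N[OF N_def P_def M' B]]
  have "x = matrix_inv M *v (transpose B *v (matrix_inv N *v d))
             - transpose P *v (matrix_inv M *v g)"
    unfolding x g_def by (rule eils_solution_closed_form[OF J M_def N_def P_def M' B])
  then have x': "x = matrix_inv M *v (g + transpose B *v l)"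
    by (simp add: transpose_P[OF N_def P_def M' B] l_def algebra_simps
        matrix_vector_mul_assoc[symmetric] matrix_vector_mult_diff_rdistrib
        matrix_vector_mult_diff_distrib matrix_vector_right_distrib)
  have Mx: "M *v x = g + transpose B *v l"
    unfolding x' by (simp add: matrix_vector_mul_assoc MI)
  have "B *v x = B *v (matrix_inv M *v g) + N *v l"
    by (simp add: x' N_def matrix_vector_right_distrib matrix_vector_mul_assoc[symmetric])
  also have "N *v l = d - B *v (matrix_inv M *v g)"
    by (simp add: l_def matrix_vector_mult_diff_distrib matrix_vector_mul_assoc matrix_mul_assoc NI)
  finally show "B *v x = d"
    by simp
  have "transpose A *v (J *v (b - A *v x)) = g - M *v x"
    by (simp add: g_def M_def matrix_vector_mult_diff_distrib matrix_vector_mul_assoc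
        matrix_mul_assoc)
  then have r: "transpose A *v (J *v (b - A *v x)) = - (transpose B *v l)"
    by (simp add: Mx)
  \<comment> \<open>Applying \<open>B\<close> to the stationarity condition and inverting
    \<open>B ** transpose B\<close> recovers \<open>l\<close>.\<close>
  have "det (B ** transpose B) \<noteq> 0"
    using B by (simp add: rank_eq_rows_iff_det_gram)
  then have "matrix_inv (B ** transpose B) ** (B ** transpose B) = mat 1"
    using matrix_inv_right matrix_left_right_inverse by blast
  moreover have "B *v (- (transpose B *v l)) = - ((B ** transpose B) *v l)"
    using matrix_vector_mult_diff_distrib[of B 0 "transpose B *v l"]
    by (simp add: matrix_vector_mul_assoc)
  moreover have "matrix_inv (B ** transpose B) *v (- v) = - (matrix_inv (B ** transpose B) *v v)" for v
    using matrix_vector_mult_diff_distrib[of "matrix_inv (B ** transpose B)" 0 v] by simp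
  ultimately have "lam = l"
    unfolding lam r by (simp add: matrix_vector_mul_assoc)
  then show "transpose A *v (J *v (b - A *v x)) + transpose B *v lam = 0"
    unfolding r by simp
qed

text \<open>The error \<open>h (f z) (w z - w0)\<close> is of order \<open>norm z\<close> times a
  null function, so convergence of \<open>w\<close> suffices. The value of \<open>w\<close> at 0 is
  irrelevant, since \<open>f\<close> vanishes there.\<close>

lemma has_derivative_bounded_bilinear_continuous_factor:
  fixes f :: "'a::real_normed_vector \<Rightarrow> 'b::real_normed_vector"
  assumes h: "bounded_bilinear h" and f: "bounded_linear f" and w: "(w \<longlongrightarrow> w0) (at 0)"
  shows "((\<lambda>z. h (f z) (w z)) has_derivative (\<lambda>z. h (f z) w0)) (at 0)"
proof -
  interpret h: bounded_bilinear h by fact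
  interpret f: bounded_linear f by fact
  obtain K where K: "0 < K" "\<And>a b. norm (h a b) \<le> norm a * norm b * K"
    using h.pos_bounded by blast
  obtain L where L: "0 < L" "\<And>z. norm (f z) \<le> norm z * L"
    using f.pos_bounded by blast
  show ?thesis
  proof (rule has_derivativeI_sandwich[where e = 1])
    show "bounded_linear (\<lambda>z. h (f z) w0)"
      by (rule bounded_linear_compose[OF h.bounded_linear_left f])
    show "((\<lambda>z. L * norm (w z - w0) * K) \<longlongrightarrow> 0) (at 0)"
      using w by (auto intro!: tendsto_eq_intros)
    fix z :: 'a assume z: "z \<noteq> 0"
    have "norm (h (f z) (w z) - h (f z) w0) \<le> norm (f z) * norm (w z - w0) * K"
      unfolding h.diff_right[symmetric] by (rule K)
    also have "\<dots> \<le> (norm z * L) * norm (w z - w0) * K"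
      using K(1) by (intro mult_right_mono L) auto
    finally show "norm (h (f z) (w z) - h (f 0) (w 0) - h (f (z - 0)) w0) / norm (z - 0)
        \<le> L * norm (w z - w0) * K"
      using z by (simp add: f.zero h.zero_left field_simps)
  qed simp
qed

text \<open>No matrix inverse is differentiated: the closed form only yields continuity of the
  perturbed solution, and the derivative comes from the exact saddle point formula for the
  difference.\<close>

lemma eils_solution_has_derivative:
  fixes A :: "real^'n^'m" and B :: "real^'n^'s" and J :: "real^'m^'m"
  assumes J: "transpose J = J" and M: "M = transpose A ** J ** A"
    and N: "N = B ** matrix_inv M ** transpose B"
    and P: "P = transpose B ** matrix_inv N ** B ** matrix_inv M - mat 1"
    and B: "rank B = CARD('s)" and M_pos: "pos_def M"
    and x: "x = eils_solution J A B b d" and r: "r = b - A *v x"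
    and lam: "lam = - (matrix_inv (B ** transpose B) *v (B *v (transpose A *v (J *v r))))"
  shows "((\<lambda>(dA, dB, db, dd). eils_solution J (A + dA) (B + dB) (b + db) (d + dd)) has_derivative
    (\<lambda>(dA, dB, db, dd). matrix_inv M *v (transpose B *v (matrix_inv N *v (dd - dB *v x)))
      - transpose P *v (matrix_inv M *v (transpose dA *v (J *v r) + transpose dB *v lam
          + transpose A *v (J *v (db - dA *v x)))))) (at 0)"
proof -
  define dA :: "(real^'n^'m) \<times> (real^'n^'s) \<times> (real^'m) \<times> (real^'s) \<Rightarrow> _" where "dA = fst"
  define dB :: "(real^'n^'m) \<times> (real^'n^'s) \<times> (real^'m) \<times> (real^'s) \<Rightarrow> _" where "dB = (\<lambda>z. fst (snd z))"
  define db :: "(real^'n^'m) \<times> (real^'n^'s) \<times> (real^'m) \<times> (real^'s) \<Rightarrow> _" where "db = (\<lambda>z. fst (snd (snd z)))"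
  define dd :: "(real^'n^'m) \<times> (real^'n^'s) \<times> (real^'m) \<times> (real^'s) \<Rightarrow> _" where "dd = (\<lambda>z. snd (snd (snd z)))"
  note proj_defs = dA_def dB_def db_def dd_def
  have lin: "bounded_linear dA" "bounded_linear dB" "bounded_linear db" "bounded_linear dd"
    unfolding proj_defs by (intro bounded_linear_fst_comp bounded_linear_snd_comp
        bounded_linear_fst bounded_linear_snd bounded_linear_intros)+
  have zero: "dA 0 = 0" "dB 0 = 0" "db 0 = 0" "dd 0 = 0"
    by (simp_all add: proj_defs)
  define A' where "A' z = A + dA z" for z
  define B' where "B' z = B + dB z" for z
  define b' where "b' z = b + db z" for z
  define d' where "d' z = d + dd z" for z
  note pert_defs = A'_def B'_def b'_def d'_def
  define M' where "M' z = transpose (A' z) ** J ** A' z" for z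
  define N' where "N' z = B' z ** matrix_inv (M' z) ** transpose (B' z)" for z
  define P' where "P' z = transpose (B' z) ** matrix_inv (N' z) ** B' z ** matrix_inv (M' z) - mat 1" for z
  define X where "X z = eils_solution J (A' z) (B' z) (b' z) (d' z)" for z
  define R where "R z = b' z - A' z *v X z" for z
  define Lm where "Lm z = - (matrix_inv (B' z ** transpose (B' z))
      *v (B' z *v (transpose (A' z) *v (J *v R z))))" for z
  note tendsto_mat = tendsto_matrix_mult tendsto_matrix_vector_mult tendsto_transpose
  have tends: "(A' \<longlongrightarrow> A) (at 0)" "(B' \<longlongrightarrow> B) (at 0)" "(b' \<longlongrightarrow> b) (at 0)" "(d' \<longlongrightarrow> d) (at 0)"
  proof -
    have "(f \<longlongrightarrow> 0) (at 0)" if "bounded_linear f" for f :: "_ \<Rightarrow> 'z::real_normed_vector"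
      using bounded_linear.tendsto[OF that tendsto_ident_at[of 0 UNIV]]
      by (simp add: linear_0[OF bounded_linear.linear[OF that]])
    note t = this[OF lin(1)] this[OF lin(2)] this[OF lin(3)] this[OF lin(4)]
    show "(A' \<longlongrightarrow> A) (at 0)" "(B' \<longlongrightarrow> B) (at 0)" "(b' \<longlongrightarrow> b) (at 0)" "(d' \<longlongrightarrow> d) (at 0)"
      unfolding pert_defs using t[THEN tendsto_add[OF tendsto_const]] by simp_all
  qed
  have M'_lim: "(M' \<longlongrightarrow> M) (at 0)"
    unfolding M'_def M by (intro tendsto_mat tendsto_const tends)
  have N'_lim: "(N' \<longlongrightarrow> N) (at 0)"
    unfolding N'_def N
    by (intro tendsto_mat tendsto_matrix_inv tends M'_lim pos_def_det M_pos)
  have N_det: "det N \<noteq> 0"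
    using pos_def_N[OF N P M_pos B] by (rule pos_def_det)
  have P'_lim: "(P' \<longlongrightarrow> P) (at 0)"
    unfolding P'_def P
    by (intro tendsto_mat tendsto_diff tendsto_const tendsto_matrix_inv tends M'_lim N'_lim
        pos_def_det M_pos N_det)
  have "transpose (M' z) = M' z" for z
    by (simp add: M'_def matrix_transpose_mul J matrix_mul_assoc)
  then have M'_pos: "\<forall>\<^sub>F z in at 0. pos_def (M' z)"
    using M'_lim M_pos by (intro eventually_pos_def)
  have B'_rank: "\<forall>\<^sub>F z in at 0. rank (B' z) = CARD('s)"
    using tends(2) B by (rule eventually_full_row_rank)
  have X_lim: "(X \<longlongrightarrow> x) (at 0)"
  proof (rule Lim_transform_eventually)
    show "\<forall>\<^sub>F z in at 0. matrix_inv (M' z) *v (transpose (B' z) *v (matrix_inv (N' z) *v d' z))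
        - transpose (P' z) *v (matrix_inv (M' z) *v (transpose (A' z) *v (J *v b' z))) = X z"
      using M'_pos B'_rank
    proof eventually_elim
      case (elim z)
      then show ?case
        unfolding X_def
        by (intro eils_solution_closed_form[symmetric] J M'_def N'_def P'_def)
    qed
    show "((\<lambda>z. matrix_inv (M' z) *v (transpose (B' z) *v (matrix_inv (N' z) *v d' z))
        - transpose (P' z) *v (matrix_inv (M' z) *v (transpose (A' z) *v (J *v b' z)))) \<longlongrightarrow> x) (at 0)"
      unfolding x eils_solution_closed_form[OF J M N P M_pos B]
      by (intro tendsto_mat tendsto_diff tendsto_const tendsto_matrix_inv tends M'_lim N'_lim
          P'_lim pos_def_det M_pos N_det)
  qed
  have R_lim: "(R \<longlongrightarrow> r) (at 0)"
    unfolding R_def r by (intro tendsto_mat tendsto_diff tends X_lim)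
  have Lm_lim: "(Lm \<longlongrightarrow> lam) (at 0)"
    unfolding Lm_def lam using B
    by (intro tendsto_mat tendsto_minus tendsto_const tendsto_matrix_inv tends R_lim)
      (simp add: rank_eq_rows_iff_det_gram)
  \<comment> \<open>The coefficients are arguments: the perturbed ones give the exact increment, the
    unperturbed ones the derivative.\<close>
  define D where "D x r lam z = matrix_inv M *v (transpose B *v (matrix_inv N *v (dd z - dB z *v x)))
      - transpose P *v (matrix_inv M *v (transpose (dA z) *v (J *v r) + transpose (dB z) *v lam
          + transpose A *v (J *v (db z - dA z *v x))))" for x r lam z
  have kkt: "B *v x = d" "transpose A *v (J *v r) + transpose B *v lam = 0"
    using eils_solution_kkt[OF J _ B x lam[unfolded r]] M_pos by (simp_all add: M r)
  have exact: "\<forall>\<^sub>F z in at 0. x + D (X z) (R z) (Lm z) z = X z"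
    using M'_pos B'_rank
  proof eventually_elim
    case (elim z)
    have kkt': "B' z *v X z = d' z"
        "transpose (A' z) *v (J *v R z) + transpose (B' z) *v Lm z = 0"
      using eils_solution_kkt[OF J _ elim(2) X_def Lm_def[unfolded R_def]] elim(1)
      by (simp_all add: M'_def R_def)
    \<comment> \<open>First block row of the saddle point system: the difference of the two
      stationarity conditions, with the increments of \<open>A\<close> and \<open>B\<close> moved to
      the right-hand side.\<close>
    have "M *v (X z - x) = (transpose (dA z) *v (J *v R z) + transpose (dB z) *v Lm z
          + transpose A *v (J *v (db z - dA z *v X z))) + transpose B *v (Lm z - lam)"
    proof -
      have "R z - r = db z - dA z *v X z - A *v (X z - x)"
        unfolding R_def r pert_defs by (simp add: algebra_simps matrix_vector_mult_diff_distrib)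
      then have "transpose A *v (J *v (R z - r))
          = transpose A *v (J *v (db z - dA z *v X z)) - M *v (X z - x)"
        by (simp add: M matrix_vector_mult_diff_distrib matrix_vector_mul_assoc[symmetric])
      moreover have "transpose A *v (J *v (R z - r)) + transpose B *v (Lm z - lam)
          + transpose (dA z) *v (J *v R z) + transpose (dB z) *v Lm z = 0"
        using kkt(2) kkt'(2)
        by (simp add: pert_defs transpose_add matrix_vector_mult_diff_distrib algebra_simps)
      moreover have "m = (a1 + b1 + e) + b2" if "u = e - m" "u + b2 + a1 + b1 = 0"
        for u e m a1 b1 b2 :: "real^'n"
      proof -
        have "m - ((a1 + b1 + e) + b2) = - (u + b2 + a1 + b1)"
          using that(1) by simp
        then show ?thesis
          by (simp add: that(2))
      qed
      ultimately show ?thesis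
        by blast
    qed
    moreover have "B *v (X z - x) = dd z - dB z *v X z"
      using kkt(1) kkt'(1)
      by (simp add: pert_defs matrix_vector_mult_diff_distrib algebra_simps)
    ultimately have "X z - x = D (X z) (R z) (Lm z) z"
      unfolding D_def by (rule saddle_point_solution[OF N P M_pos B])
    then show ?case
      by (simp add: algebra_simps)
  qed
  have lin_t: "bounded_linear (\<lambda>z. transpose (dA z))" "bounded_linear (\<lambda>z. transpose (dB z))"
    by (intro bounded_linear_compose[OF bounded_linear_transpose] lin)+
  note factor = has_derivative_bounded_bilinear_continuous_factor[OF bounded_bilinear_matrix_vector_mult]
  note mat_lin = bounded_linear.has_derivative[OF matrix_vector_mul_bounded_linear]
  have J_R_lim: "((\<lambda>z. J *v R z) \<longlongrightarrow> J *v r) (at 0)"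
    by (intro tendsto_mat tendsto_const R_lim)
  \<comment> \<open>Each term of \<open>D\<close> is linear in the increment, or a bilinear product
    of such a factor with a convergent coefficient.\<close>
  have "((\<lambda>z. x + D (X z) (R z) (Lm z) z) has_derivative (\<lambda>z. 0 + D x r lam z)) (at 0)"
    unfolding D_def
    by (intro has_derivative_add has_derivative_diff has_derivative_const mat_lin factor
        bounded_linear_imp_has_derivative lin lin_t X_lim J_R_lim Lm_lim)
  \<comment> \<open>\<open>exact\<close> holds only on a punctured neighbourhood, so agreement at 0
    is checked separately.\<close>
  moreover have "x + D (X 0) (R 0) (Lm 0) 0 = X 0"
    by (simp add: D_def X_def zero pert_defs x
        linear_0[OF bounded_linear.linear[OF bounded_linear_transpose]])
  ultimately have "(X has_derivative (\<lambda>z. 0 + D x r lam z)) (at 0)"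
    using has_derivative_transform_eventually[OF _ exact] by blast
  moreover have "X = (\<lambda>(dA, dB, db, dd). eils_solution J (A + dA) (B + dB) (b + db) (d + dd))"
    by (auto simp: X_def pert_defs proj_defs)
  ultimately show ?thesis
    by (simp add: D_def proj_defs case_prod_unfold)
qed

end

subsection \<open>Column stacking and Kronecker products\<close>

lemma sum_Plus: "(\<Sum>j\<in>UNIV. f j) = (\<Sum>a\<in>UNIV. f (Inl a)) + (\<Sum>c\<in>UNIV. f (Inr c))"
  for f :: "'a::finite + 'c::finite \<Rightarrow> 'b::comm_monoid_add"
  by (simp add: UNIV_Plus_UNIV[symmetric] sum.Plus del: UNIV_Plus_UNIV)

lemma hcat_mult_vcat: "(X |\<^sub>h Y) *v vcat u v = X *v u + Y *v v"
  by (simp add: vec_eq_iff matrix_vector_mult_def hcat_def vcat_def sum_Plus)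

lemma sum_pairs: "(\<Sum>l\<in>UNIV. f (fst l) (snd l)) = (\<Sum>j\<in>UNIV. \<Sum>i\<in>UNIV. f j i)"
  for f :: "'a::finite \<Rightarrow> 'c::finite \<Rightarrow> 'b::comm_monoid_add"
  by (simp add: sum.cartesian_product case_prod_unfold)

text \<open>One-row case of the rule that a Kronecker product acts on a stacked matrix as
  multiplication from both sides; it handles the terms in which a perturbation is applied to
  \<open>x\<close>.\<close>

lemma kron_rowvector_left_mult_mat_vec:
  fixes X :: "real^'n^'m" and K :: "real^'m^'k"
  shows "rows_from_left_unit ((rowvector x :: real^'n^1) \<otimes>\<^sub>K K) *v mat_vec X = K *v (X *v x)"
proof -
  have "(\<Sum>j\<in>UNIV. \<Sum>i\<in>UNIV. x $ j * K $ k $ i * X $ i $ j)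
      = (\<Sum>i\<in>UNIV. K $ k $ i * (\<Sum>j\<in>UNIV. X $ i $ j * x $ j))" for k
    by (subst sum.swap) (simp add: sum_distrib_left mult_ac)
  then show ?thesis
    using sum_pairs[of "\<lambda>j i. x $ j * K $ k $ i * X $ i $ j" for k]
    by (simp add: vec_eq_iff matrix_vector_mult_def rows_from_left_unit_def kron_def rowvector_def
        mat_vec_def)
qed

text \<open>The companion case with the row vector as right factor; it handles the terms with a
  transposed perturbation, applied to \<open>J *v r\<close> or \<open>lam\<close>.\<close>

lemma kron_rowvector_right_mult_mat_vec:
  fixes X :: "real^'n^'m" and K :: "real^'n^'k"
  shows "rows_from_right_unit (K \<otimes>\<^sub>K (rowvector y :: real^'m^1)) *v mat_vec X
    = K *v (transpose X *v y)"
proof -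
  have "(\<Sum>j\<in>UNIV. \<Sum>i\<in>UNIV. K $ k $ j * y $ i * X $ i $ j)
      = (\<Sum>j\<in>UNIV. K $ k $ j * (\<Sum>i\<in>UNIV. X $ i $ j * y $ i))" for k
    by (simp add: sum_distrib_left mult_ac)
  then show ?thesis
    using sum_pairs[of "\<lambda>j i. K $ k $ j * y $ i * X $ i $ j" for k]
    by (simp add: vec_eq_iff matrix_vector_mult_def rows_from_right_unit_def kron_def rowvector_def
        mat_vec_def transpose_def del: transpose_matrix_vector)
qed

lemma diag_mat_mult: "diag_mat v *v w = v * w"
  by (simp add: vec_eq_iff matrix_vector_mult_def diag_mat_def if_distrib[of "\<lambda>c. c * _"]
      cong: if_cong)

lemma data_vec_mult:
  "data_vec (\<Phi> * A) (\<Psi> * B) (\<beta> * b) (\<theta> * d) = data_vec \<Phi> \<Psi> \<beta> \<theta> * data_vec A B b d"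
  by (simp add: vec_eq_iff data_vec_def vcat_def mat_vec_def split: sum.split)

lemma data_vec_nth_eq_0_iff: "data_vec A B b d $ j = 0 \<longleftrightarrow>
   (case j of Inl l \<Rightarrow> A $ snd l $ fst l = 0 | Inr (Inl l) \<Rightarrow> B $ snd l $ fst l = 0
     | Inr (Inr (Inl i)) \<Rightarrow> b $ i = 0 | Inr (Inr (Inr i)) \<Rightarrow> d $ i = 0)"
  by (simp add: data_vec_def vcat_def mat_vec_def split: sum.split)

lemma data_vec_surj: "\<exists>A B b d. u = data_vec A B b d"
proof (intro exI)
  show "u = data_vec (\<chi> i j. u $ Inl (j, i)) (\<chi> i j. u $ Inr (Inl (j, i)))
      (\<chi> i. u $ Inr (Inr (Inl i))) (\<chi> i. u $ Inr (Inr (Inr i)))"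
    by (simp add: vec_eq_iff data_vec_def vcat_def mat_vec_def split: sum.split)
qed

lemma data_vec_eq_0_iff: "data_vec A B b d = 0 \<longleftrightarrow> A = 0 \<and> B = 0 \<and> b = 0 \<and> d = 0"
  by (auto simp: vec_eq_iff data_vec_nth_eq_0_iff split: sum.split)

lemma linear_data_vec: "linear (\<lambda>(A, B, b, d). data_vec A B b d)"
  by (auto simp: linear_iff vec_eq_iff data_vec_def vcat_def mat_vec_def split: sum.split)

lemma matrix_vector_mult_uminus:
  fixes X :: "real^'n^'m"
  shows "(- X) *v v = - (X *v v)" "X *v (- v) = - (X *v v)"
  using matrix_vector_mult_diff_rdistrib[of 0 X v] matrix_vector_mult_diff_distrib[of X 0 v]
  by simp_all

lemma transpose_sig_mat: "transpose (sig_mat p) = sig_mat p"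
  by (simp add: vec_eq_iff transpose_def sig_mat_def diag_mat_def)

section \<open>The condition number as the induced norm of the weighted derivative\<close>

theorem theorem3p2:
  fixes A :: "real^'n^('m::{finite,linorder})" and B :: "real^'n^'s"
    and b :: "real^('m::_)" and d :: "real^'s" and x :: "real^'n"
    and p q :: nat
    and L :: "real^'k^'n" and \<xi> :: "real^'k"
    and \<eta> :: "real^('n \<times> 'm + 'n \<times> 's + 'm + 's) \<Rightarrow> real" and \<nu> :: "real^'k \<Rightarrow> real"
    and \<Phi> :: "real^'n^('m::_)" and \<Psi> :: "real^'n^'s" and \<beta> :: "real^('m::_)" and \<theta> :: "real^'s"
    and J :: "real^('m::_)^('m::_)" and M P :: "real^'n^'n" and N :: "real^'s^'s"
    and r :: "real^('m::_)" and lam :: "real^'s"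
    and Gam :: "real^('n \<times> 'm)^'n" and Om :: "real^('n \<times> 's)^'n"
    and MF :: "real^('n \<times> 'm + 'n \<times> 's + 'm + 's)^'n"
  assumes "p + q = CARD('m)"
    and J: "J = sig_mat p"
    and M: "M = transpose A ** J ** A"
    and N: "N = B ** matrix_inv M ** transpose B"
    and P: "P = transpose B ** matrix_inv N ** B ** matrix_inv M - mat 1"
    and "rank B = CARD('s)" and "pos_def (transpose A ** J ** A)"
    and "eils_minimizer J A B b d x"
    and "rank L = CARD('k)"
    and "vector_norm \<eta>" and "vector_norm \<nu>"
    and "\<forall>i j. \<Phi> $ i $ j \<noteq> 0" and "\<forall>i j. \<Psi> $ i $ j \<noteq> 0"
    and "\<forall>i. \<beta> $ i \<noteq> 0" and "\<forall>i. \<theta> $ i \<noteq> 0"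
    and r: "r = b - A *v x"
    and lam: "lam = - (matrix_inv (B ** transpose B) *v (B *v (transpose A *v (J *v r))))"
    and Gam: "Gam =
      rows_from_left_unit
        ((rowvector x :: real^'n^1) \<otimes>\<^sub>K (transpose P ** matrix_inv M ** transpose A ** J))
      - rows_from_right_unit ((matrix_inv M ** P) \<otimes>\<^sub>K (rowvector (J *v r) :: real^('m::_)^1))"
    and Om: "Om =
      rows_from_right_unit ((matrix_inv M ** P) \<otimes>\<^sub>K (rowvector lam :: real^'s^1))
      + rows_from_left_unit
          ((rowvector x :: real^'n^1) \<otimes>\<^sub>K (matrix_inv M ** transpose B ** matrix_inv N))"
    and MF: "MF = Gam |\<^sub>h (- Om)
      |\<^sub>h (- (transpose P ** matrix_inv M ** transpose A ** J))
      |\<^sub>h (matrix_inv M ** transpose B ** matrix_inv N)"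
  shows "(\<exists>l. (cond_quotient_sup \<eta> \<nu> \<xi> \<Phi> \<Psi> \<beta> \<theta> (projected_solution L J) A B b d
                 \<longlongrightarrow> l) (at_right 0)) \<and>
         projected_cond \<eta> \<nu> \<xi> \<Phi> \<Psi> \<beta> \<theta> (projected_solution L J) A B b d =
           ereal (induced_norm \<eta> \<nu>
             (diag_mat \<xi> **
               (transpose L ** MF ** diag_mat (ddagger (data_vec \<Phi> \<Psi> \<beta> \<theta>)))))"
proof -
  have J_sym: "transpose J = J"
    unfolding J by (rule transpose_sig_mat)
  have M_pos: "pos_def M" and B: "rank B = CARD('s)"
    using assms by simp_all
  have x_sol: "x = eils_solution J A B b d"
    using eils_closed_form_unique_minimizer[OF J_sym M N P M_pos B]
      eils_solution_closed_form[OF J_sym M N P M_pos B] \<open>eils_minimizer J A B b d x\<close> by metis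
  \<comment> \<open>\<open>S\<close> stacks the weighted perturbation, so \<eta> after
    \<open>S\<close> is the denominator of the difference quotients.\<close>
  define S where "S = (\<lambda>(dA :: real^'n^('m::_), dB :: real^'n^'s, db :: real^('m::_), dd :: real^'s).
    data_vec (\<Phi> * dA) (\<Psi> * dB) (\<beta> * db) (\<theta> * dd))"
  define \<rho> where "\<rho> = data_vec \<Phi> \<Psi> \<beta> \<theta>"
  have \<rho>: "\<rho> $ j \<noteq> 0" for j
    using assms by (simp add: \<rho>_def data_vec_nth_eq_0_iff split: sum.split)
  have S_eq: "S (dA, dB, db, dd) = \<rho> * data_vec dA dB db dd" for dA dB db dd
    by (simp add: S_def \<rho>_def data_vec_mult)
  \<comment> \<open>No weight is zero, so \<open>ddagger\<close> is the entrywise reciprocal here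
    and its default value 1 never occurs.\<close>
  have dagger: "ddagger \<rho> * (\<rho> * u) = u" "\<rho> * (ddagger \<rho> * u) = u" for u
    using \<rho> by (simp_all add: vec_eq_iff ddagger_def)
  have S_lin: "linear S"
  proof -
    have "linear ((*v) (diag_mat \<rho>) \<circ> (\<lambda>(A, B, b, d). data_vec A B b d))"
      by (intro linear_compose linear_data_vec matrix_vector_mul_linear)
    moreover have "S = (*v) (diag_mat \<rho>) \<circ> (\<lambda>(A, B, b, d). data_vec A B b d)"
      by (auto simp: S_eq diag_mat_mult)
    ultimately show ?thesis
      by simp
  qed
  have S_ker: "z = 0" if "S z = 0" for z
  proof (cases z)
    case (fields dA dB db dd)
    have "ddagger \<rho> * S z = 0"
      by (simp add: that)
    then have "data_vec dA dB db dd = 0"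
      unfolding fields S_eq dagger .
    then show ?thesis
      by (simp add: data_vec_eq_0_iff fields zero_prod_def)
  qed
  \<comment> \<open>Surjectivity of \<open>S\<close> lets the supremum in the induced norm run over
    data perturbations instead of stacked vectors.\<close>
  have S_image: "S ` {z. z \<noteq> 0} = {u. u \<noteq> 0}"
  proof -
    have "\<exists>z. S z = u" for u
      using data_vec_surj[of "ddagger \<rho> * u"] S_eq dagger(2)[of u] by metis
    then show ?thesis
      using S_ker linear_0[OF S_lin] by (auto simp: image_iff) metis
  qed
  define D where "D = (\<lambda>(dA :: real^'n^('m::_), dB :: real^'n^'s, db :: real^('m::_), dd :: real^'s).
    matrix_inv M *v (transpose B *v (matrix_inv N *v (dd - dB *v x)))
      - transpose P *v (matrix_inv M *v (transpose dA *v (J *v r) + transpose dB *v lam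
          + transpose A *v (J *v (db - dA *v x)))))"
  define X where "X = diag_mat \<xi> ** (transpose L ** MF ** diag_mat (ddagger \<rho>))"
  \<comment> \<open>The terms of the derivative are collected by perturbation: those in
    \<open>dA\<close> form \<open>Gam\<close>, those in \<open>dB\<close> form
    \<open>- Om\<close>.\<close>
  have MF_mult: "MF *v data_vec dA dB db dd = D (dA, dB, db, dd)" for dA dB db dd
    unfolding MF data_vec_def hcat_mult_vcat D_def Gam Om
    using transpose_P_mult_inv[OF N P M_pos B]
    by (simp add: matrix_vector_mult_uminus matrix_vector_mult_add_rdistrib
        matrix_vector_mult_diff_rdistrib matrix_vector_mult_diff_distrib matrix_vector_right_distrib
        kron_rowvector_left_mult_mat_vec kron_rowvector_right_mult_mat_vec
        matrix_vector_mul_assoc matrix_mul_assoc del: transpose_matrix_vector)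
  \<comment> \<open>The factor \<open>diag_mat (ddagger \<rho>)\<close> undoes the weighting
    contained in \<open>S\<close>.\<close>
  have X_mult: "X *v S z = \<xi> * (transpose L *v D z)" for z
  proof (cases z)
    case (fields dA dB db dd)
    have "X *v S z = diag_mat \<xi> *v (transpose L *v (MF *v (diag_mat (ddagger \<rho>) *v S z)))"
      unfolding X_def by (simp add: matrix_vector_mul_assoc matrix_mul_assoc)
    then show ?thesis
      unfolding fields S_eq diag_mat_mult dagger(1) MF_mult .
  qed
  define G where "G = (\<lambda>(dA, dB, db, dd).
    \<xi> * projected_solution L J (A + dA) (B + dB) (b + db) (d + dd))"
  have "((\<lambda>z. diag_mat \<xi> *v (transpose L *v (case z of (dA, dB, db, dd) \<Rightarrow>
      eils_solution J (A + dA) (B + dB) (b + db) (d + dd))))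
    has_derivative (\<lambda>z. diag_mat \<xi> *v (transpose L *v D z))) (at 0)"
    unfolding D_def
    by (intro bounded_linear.has_derivative[OF matrix_vector_mul_bounded_linear]
        eils_solution_has_derivative[OF J_sym M N P B M_pos x_sol r lam])
  then have G_deriv: "(G has_derivative (\<lambda>z. X *v S z)) (at 0)"
    by (simp add: G_def X_mult projected_solution_def diag_mat_mult case_prod_unfold)
  have "cond_quotient_sup \<eta> \<nu> \<xi> \<Phi> \<Psi> \<beta> \<theta> (projected_solution L J) A B b d
      = (\<lambda>\<delta>. SUP z\<in>{z. 0 < \<eta> (S z) \<and> \<eta> (S z) \<le> \<delta>}. ereal (\<nu> (G z - G 0) / \<eta> (S z)))"
    by (simp add: fun_eq_iff cond_quotient_sup_def S_def G_def case_prod_unfold right_diff_distrib)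
  moreover have "induced_norm \<eta> \<nu> X = (SUP z\<in>{z. z \<noteq> 0}. \<nu> (X *v S z) / \<eta> (S z))"
    unfolding induced_norm_def S_image[symmetric] image_image ..
  ultimately have lim: "(cond_quotient_sup \<eta> \<nu> \<xi> \<Phi> \<Psi> \<beta> \<theta> (projected_solution L J) A B b d
      \<longlongrightarrow> ereal (induced_norm \<eta> \<nu> X)) (at_right 0)"
    using tendsto_SUP_vector_norm_difference_quotient[OF G_deriv
        vector_norm_comp_linear[OF \<open>vector_norm \<eta>\<close> S_lin S_ker] \<open>vector_norm \<nu>\<close>] by simp
  \<comment> \<open>\<open>Lim\<close> is a description operator; the convergence just shown, with
    uniqueness of limits, determines its value.\<close>
  moreover have "projected_cond \<eta> \<nu> \<xi> \<Phi> \<Psi> \<beta> \<theta> (projected_solution L J) A B b d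
      = ereal (induced_norm \<eta> \<nu> X)"
    unfolding projected_cond_def using lim by (intro tendsto_Lim) simp_all
  ultimately show ?thesis
    unfolding X_def \<rho>_def by blast
qed

end
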